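(* Let $d\in\mathbb{N}$, $0<p<\infty$ and $\varphi\in\mathcal{G}_p$ with $\varphi(1)=1$ and $\lim_{t\to0^+}\varphi(t)=0$. Let $\mathcal{E}_{\mathsf G}^{X}$ denote the growth envelope function of $X=\mathcal{M}_{\varphi,p}(\mathbb{R}^d)$. (a) If $\lim_{t\to\infty}t^{-d/p}\varphi(t)=0$, then $\mathcal{E}_{\mathsf G}^{X}(t)=\infty$ for all $t>0$. (b) If $\lim_{t\to\infty}t^{-d/p}\varphi(t)=c>0$, then $\mathcal{E}_{\mathsf G}^{X}(t)\sim t^{-1/p}$ for $t>0$.
   Context: $\mathcal{G}_p$ is the set of all nondecreasing functions $\varphi:(0,\infty)\to(0,\infty)$ such that $t\mapsto \varphi(t)t^{-d/p}$ is nonincreasing. For $\varphi\in\mathcal{G}_p$, the generalised Morrey space $\mathcal{M}_{\varphi,p}(\mathbb{R}^d)$ is the set of all $f\in L_p^{\mathrm{loc}}(\mathbb{R}^d)$ with $$\|f\mid\mathcal{M}_{\varphi,p}(\mathbb{R}^d)\|:=\sup_{Q}\varphi(\ell(Q))\Big(\frac{1}{|Q|}\int_Q|f(y)|^p\,dy\Big)^{1/p}<\infty,$$ the supremum being over all dyadic cubes $Q=2^{-j}([0,1)^d+k)$, $j\in\mathbb{Z}$, $k\in\mathbb{Z}^d$, where $\ell(Q)$ is the side length; taking all cubes with sides parallel to the axes (or all balls, with the radius in place of $\ell(Q)$) gives an equivalent quasi-norm. For measurable $f$ on $\mathbb{R}^d$, finite a.e., $f^*(t)=\inf\{\sigma>0:\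 |\{x:|f(x)|>\sigma\}|\le t\}$, $t\ge 0$ (with $\inf\emptyset=\infty$). The growth envelope function of a quasi-normed function space $X$ on $\mathbb{R}^d$ is $\mathcal{E}_{\mathsf G}^{X}(t)=\sup_{\|f\mid X\|\le 1}f^*(t)\in[0,\infty]$, $t>0$. $A(t)\sim B(t)$ on a range of $t$ means that there are constants $c_1,c_2>0$ independent of $t$ with $c_1A(t)\le B(t)\le c_2A(t)$ on that range. *)

theory Defs
  imports "HOL-Analysis.Analysis"
begin

text \<open>
  \<open>\<real>\<^sup>d\<close> is the type \<open>real ^ 'd\<close>, with \<open>d = CARD('d)\<close>. Function spaces consist of complex-valued
  functions rather than of classes of functions modulo equality almost everywhere; all notions
  below are invariant under changes on Lebesgue null sets.
\<close>

text \<open>Functions on \<open>(0,\<infinity>)\<close> are total functions on \<open>real\<close> whose values outside \<open>(0,\<infinity>)\<close> are ignored.\<close>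

definition G_class :: "nat \<Rightarrow> real \<Rightarrow> (real \<Rightarrow> real) set" where
  "G_class d p = {\<phi>. (\<forall>t>0. \<phi> t > 0) \<and> mono_on {0<..} \<phi> \<and>
     antimono_on {0<..} (\<lambda>t. \<phi> t * t powr (- real d / p))}"

definition dyadic_cube :: "int \<Rightarrow> int ^ 'd \<Rightarrow> (real ^ 'd) set" where
  "dyadic_cube j k =
     (\<lambda>x. (2 powi (- j)) *\<^sub>R (x + (\<chi> i. of_int (k $ i)))) ` {x. \<forall>i. 0 \<le> x $ i \<and> x $ i < 1}"

definition Lp_loc :: "real \<Rightarrow> (real ^ 'd \<Rightarrow> complex) set" where
  "Lp_loc p = {f \<in> borel_measurable lebesgue.
     \<forall>K. compact K \<longrightarrow> set_integrable lebesgue K (\<lambda>x. norm (f x) powr p)}"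

text \<open>
  The cube with indices \<open>(j, k)\<close> has side length \<open>2 powi (- j)\<close>. Outside \<open>Lp_loc p\<close> the Bochner
  integrals may take the default value \<open>0\<close>, so the quasi-norm is meaningful only for \<open>f \<in> Lp_loc p\<close>.
\<close>

definition morrey_norm :: "(real \<Rightarrow> real) \<Rightarrow> real \<Rightarrow> (real ^ 'd \<Rightarrow> complex) \<Rightarrow> ennreal" where
  "morrey_norm \<phi> p f = (SUP (j, k) \<in> UNIV.
     ennreal (\<phi> (2 powi (- j)) *
       (1 / measure lebesgue (dyadic_cube j k) *
         (LINT y : dyadic_cube j k | lebesgue. norm (f y) powr p)) powr (1 / p)))"

definition morrey_space :: "(real \<Rightarrow> real) \<Rightarrow> real \<Rightarrow> (real ^ 'd \<Rightarrow> complex) set" where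
  "morrey_space \<phi> p = {f \<in> Lp_loc p. morrey_norm \<phi> p f < \<infinity>}"

text \<open>In \<open>ennreal\<close> the infimum of the empty set is \<open>\<infinity>\<close>.\<close>

definition decr_rearrangement :: "(real ^ 'd \<Rightarrow> complex) \<Rightarrow> real \<Rightarrow> ennreal" where
  "decr_rearrangement f t =
     (INF \<sigma> \<in> {\<sigma>::real. \<sigma> > 0 \<and> emeasure lebesgue {x. norm (f x) > \<sigma>} \<le> ennreal t}. ennreal \<sigma>)"

text \<open>A quasi-normed function space is given by its carrier \<open>X\<close> and its quasi-norm \<open>N\<close>.\<close>

definition growth_envelope ::
  "(real ^ 'd \<Rightarrow> complex) set \<Rightarrow> ((real ^ 'd \<Rightarrow> complex) \<Rightarrow> ennreal) \<Rightarrow> real \<Rightarrow> ennreal" where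
  "growth_envelope X N t = (SUP f \<in> {f \<in> X. N f \<le> 1}. decr_rearrangement f t)"

definition sim_on :: "real set \<Rightarrow> (real \<Rightarrow> ennreal) \<Rightarrow> (real \<Rightarrow> ennreal) \<Rightarrow> bool" where
  "sim_on T A B \<longleftrightarrow> (\<exists>c1 c2 :: real. c1 > 0 \<and> c2 > 0 \<and>
     (\<forall>t\<in>T. ennreal c1 * A t \<le> B t \<and> B t \<le> ennreal c2 * A t))"

end

theory Submission
  imports Defs
begin

text \<open>
  Every lower bound comes from one family of test functions \<open>h * indicator A\<close>, where \<open>A\<close> is a
  grid of cubes of side \<open>s\<close>, spaced at distance \<open>r\<close> inside a cube of side \<open>L = 2\<^sup>a\<close>, with
  \<open>s / r = 2 powi (b - a)\<close>; so \<open>A\<close> has measure \<open>2\<^bsup>bd\<^esup>\<close> for every \<open>s\<close>. Monotonicity of \<open>\<phi>\<close> and of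
  \<open>\<phi>(t) t\<^bsup>-d/p\<^esup>\<close> shows that the critical dyadic cubes in the Morrey norm are those of side \<open>L\<close>
  and of side \<open>s\<close>; since \<open>\<phi>\<close> vanishes at \<open>0\<close>, the latter impose no condition once \<open>s\<close> is small.
  What is left, \<open>h * \<phi>(L) * (s / r) powr (d / p) \<le> 1\<close>, allows arbitrarily large \<open>h\<close> as \<open>L \<rightarrow> \<infinity>\<close> with
  \<open>b\<close> fixed in case (a), and \<open>h = 2\<^bsup>-bd/p\<^esup>\<close> for \<open>L = max 2\<^sup>b 1\<close> in general, since \<open>\<phi>(L) \<le> L\<^bsup>d/p\<^esup>\<close> for
  \<open>L \<ge> 1\<close>. In case (b), \<open>\<phi>(t) \<ge> c t\<^bsup>d/p\<^esup>\<close>, so that the Morrey norm controls the \<open>L\<^sub>p\<close> norm on each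
  dyadic cube, uniformly, hence on each orthant, and Chebyshev's inequality gives the upper bound.
\<close>

section \<open>Lebesgue measure of product sets in \<open>real ^ 'd\<close>\<close>

text \<open>By definition \<open>lborel\<close> is the image of the product over
  \<open>Basis\<close> of one-dimensional measures under
  \<open>f \<mapsto> \<Sum>b\<in>Basis. f b *\<^sub>R b\<close>, and under this map the preimage of
  the set is again a box.\<close>

lemma
  fixes B :: "'d::finite \<Rightarrow> real set"
  assumes B: "\<And>i. B i \<in> sets borel"
  shows sets_borel_vec_prod: "{x :: real ^ 'd. \<forall>i. x $ i \<in> B i} \<in> sets borel"
    and emeasure_lborel_vec_prod:
     "emeasure lborel {x :: real ^ 'd. \<forall>i. x $ i \<in> B i} = (\<Prod>i\<in>UNIV. emeasure lborel (B i))"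
proof -
  let ?S = "{x :: real ^ 'd. \<forall>i. x $ i \<in> B i}"
  have "(\<lambda>x :: real ^ 'd. x $ i) \<in> borel_measurable borel" for i
    by (intro borel_measurable_continuous_onI continuous_intros)
  from measurable_sets_borel[OF this B]
  have "(\<Inter>i. (\<lambda>x :: real ^ 'd. x $ i) -` B i) \<in> sets borel"
    by (intro sets.countable_INT') auto
  also have "(\<Inter>i. (\<lambda>x :: real ^ 'd. x $ i) -` B i) = ?S" by auto
  finally show S: "?S \<in> sets borel" .
  interpret product_sigma_finite "\<lambda>_::real ^ 'd. interval_measure (\<lambda>x. x)"
    unfolding product_sigma_finite_def by (auto intro!: sigma_finite_interval_measure)
  have L: "interval_measure (\<lambda>x. x) = lborel"
    by (rule lborel_eq_real[symmetric])
  \<comment> \<open>The factors of the product measure are indexed by basis vectors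
    \<open>axis i 1\<close> instead of coordinates \<open>i\<close>; \<open>axis_index\<close>
    translates back.\<close>
  define C where "C b = B (axis_index b)" for b :: "real ^ 'd"
  have bas: "(Basis :: (real ^ 'd) set) = range (\<lambda>i. axis i 1)"
    by (auto simp: Basis_vec_def)
  have inj: "inj (\<lambda>i. axis i 1 :: real ^ 'd)"
    by (auto simp: inj_on_def axis_eq_axis)
  have comp: "(\<Sum>b\<in>Basis. f b *\<^sub>R b) $ i = f (axis i 1)" for f :: "real ^ 'd \<Rightarrow> real" and i :: 'd
    unfolding bas by (subst sum.reindex[OF inj]) (simp add: axis_def if_distrib cong: if_cong)
  have v: "(\<lambda>f. \<Sum>b\<in>Basis. f b *\<^sub>R b) -` ?S \<inter>
      space (\<Pi>\<^sub>M b\<in>(Basis :: (real ^ 'd) set). interval_measure (\<lambda>x. x)) = Pi\<^sub>E Basis C"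
    unfolding vimage_def mem_Collect_eq comp by (auto simp: space_PiM PiE_iff C_def bas)
  have "emeasure lborel ?S = emeasure (\<Pi>\<^sub>M b\<in>(Basis :: (real ^ 'd) set). interval_measure (\<lambda>x. x)) (Pi\<^sub>E Basis C)"
    unfolding lborel_def[where 'a = "real ^ 'd"]
    by (subst emeasure_distr; (simp only: v | rule S | simp))
  also have "\<dots> = (\<Prod>b\<in>Basis. emeasure (interval_measure (\<lambda>x. x)) (C b))"
    by (rule emeasure_PiM) (auto simp: C_def B)
  also have "\<dots> = (\<Prod>i\<in>UNIV. emeasure lborel (B i))"
    by (subst bas, subst prod.reindex[OF inj]) (simp add: L C_def)
  finally show "emeasure lborel ?S = (\<Prod>i\<in>UNIV. emeasure lborel (B i))" .
qed

section \<open>One-dimensional combs and their intersections with dyadic intervals\<close>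

text \<open>The grid is the \<open>d\<close>-fold product of this set: \<open>N\<close> teeth of
  length \<open>s\<close>, one at the left end of each period of length \<open>r\<close>.\<close>

definition comb :: "real \<Rightarrow> real \<Rightarrow> int \<Rightarrow> real set" where
  "comb s r N = (\<Union>q\<in>{0..<N}. {of_int q * r ..< of_int q * r + s})"

lemma comb_borel [measurable]: "comb s r N \<in> sets borel"
  unfolding comb_def by (intro sets.finite_UN) auto

text \<open>Because \<open>s \<le> r\<close>, a tooth does not leave its own period. This gives
  disjointness of the teeth and lets them be counted by values of
  \<open>\<lfloor>x / r\<rfloor>\<close>.\<close>

lemma floor_in_tooth:
  assumes "0 < s" "s \<le> r" "x \<in> {of_int q * r ..< of_int q * r + s}"
  shows "\<lfloor>x / r\<rfloor> = q"
  using assms by (intro floor_unique) (auto simp: field_simps)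

lemma emeasure_comb:
  assumes "0 < s" "s \<le> r" "0 \<le> N"
  shows "emeasure lborel (comb s r N) = ennreal (of_int N * s)"
proof -
  have "disjoint_family_on (\<lambda>q. {of_int q * r ..< of_int q * r + s}) {0..<N}"
    unfolding disjoint_family_on_def using floor_in_tooth[OF assms(1,2)] by blast
  then have "emeasure lborel (comb s r N) = (\<Sum>q\<in>{0..<N}. emeasure lborel {of_int q * r ..< of_int q * r + s})"
    unfolding comb_def by (intro sum_emeasure[symmetric]) auto
  also have "\<dots> = ennreal (of_int N * s)"
    using assms by (simp add: ennreal_of_nat_eq_real_of_nat flip: ennreal_mult)
  finally show ?thesis .
qed

lemma emeasure_comb_interval_le:
  assumes s: "0 < s" "s \<le> r" and I: "\<And>x. x \<in> I \<Longrightarrow> \<lfloor>x / r\<rfloor> \<in> {a..<a + int n}"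
  shows "emeasure lborel (comb s r N \<inter> I) \<le> ennreal (real n * s)"
proof -
  have "comb s r N \<inter> I \<subseteq> (\<Union>q\<in>{a..<a + int n}. {of_int q * r ..< of_int q * r + s})"
    using I floor_in_tooth[OF s] unfolding comb_def by blast
  then have "emeasure lborel (comb s r N \<inter> I) \<le> emeasure lborel (\<Union>q\<in>{a..<a + int n}. {of_int q * r ..< of_int q * r + s})"
    by (intro emeasure_mono) auto
  also have "\<dots> \<le> (\<Sum>q\<in>{a..<a + int n}. emeasure lborel {of_int q * r ..< of_int q * r + s})"
    by (intro emeasure_subadditive_finite) auto
  also have "\<dots> = ennreal (real n * s)"
    using s by (simp add: ennreal_of_nat_eq_real_of_nat flip: ennreal_mult)
  finally show ?thesis .
qed

text \<open>The interval consists of \<open>2 ^ v\<close> whole periods, each with at most one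
  tooth, and \<open>2 ^ v * s = l * s / r\<close>.\<close>

lemma emeasure_comb_coarse:
  assumes s: "0 < s" "s \<le> r" and l: "l = 2 ^ v * r"
  shows "emeasure lborel (comb s r N \<inter> {l * of_int k ..< l * (of_int k + 1)}) \<le> ennreal (l * s / r)"
proof -
  have "emeasure lborel (comb s r N \<inter> {l * of_int k ..< l * (of_int k + 1)}) \<le> ennreal (real (2 ^ v) * s)"
  proof (rule emeasure_comb_interval_le[OF s])
    fix x assume "x \<in> {l * of_int k ..< l * (of_int k + 1)}"
    then have "of_int (2 ^ v * k) \<le> x / r" "x / r < of_int (2 ^ v * k + int (2 ^ v))"
      using s l by (auto simp: field_simps)
    then show "\<lfloor>x / r\<rfloor> \<in> {2 ^ v * k ..< 2 ^ v * k + int (2 ^ v)}"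
      by (auto simp: le_floor_iff floor_less_iff)
  qed
  then show ?thesis using s l by simp
qed

text \<open>Since \<open>r / l\<close> is a power of two and the interval is aligned, it lies in the
  single period with index \<open>k div 2 ^ v\<close>, so it meets at most one tooth.\<close>

lemma emeasure_comb_fine:
  assumes s: "0 < s" "s \<le> r" and l: "r = 2 ^ v * l"
  shows "emeasure lborel (comb s r N \<inter> {l * of_int k ..< l * (of_int k + 1)}) \<le> ennreal s"
proof -
  have "0 < 2 ^ v * l" using s l by linarith
  then have l0: "l > 0" by (simp add: zero_less_mult_iff)
  have "emeasure lborel (comb s r N \<inter> {l * of_int k ..< l * (of_int k + 1)}) \<le> ennreal (real 1 * s)"
  proof (rule emeasure_comb_interval_le[OF s])
    fix x assume x: "x \<in> {l * of_int k ..< l * (of_int k + 1)}"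
    then have "\<lfloor>x / l\<rfloor> = k"
      using l0 by (intro floor_unique) (auto simp: field_simps)
    moreover have "\<lfloor>x / r\<rfloor> = \<lfloor>x / l\<rfloor> div 2 ^ v"
      using floor_divide_real_eq_div[of "2 ^ v" "x / l"] l l0 by (simp add: field_simps)
    ultimately show "\<lfloor>x / r\<rfloor> \<in> {k div 2 ^ v ..< k div 2 ^ v + int 1}" by simp
  qed
  then show ?thesis by simp
qed

section \<open>Dyadic cubes as products of intervals, and the measure of the grid in them\<close>

lemma dyadic_cube_eq:
  "dyadic_cube j k = {x. \<forall>i. x $ i \<in> {2 powi (- j) * of_int (k $ i) ..< 2 powi (- j) * (of_int (k $ i) + 1)}}"
    (is "_ = ?S")
proof (intro equalityI subsetI)
  fix x assume "x \<in> dyadic_cube j k"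
  then show "x \<in> ?S" unfolding dyadic_cube_def by auto
next
  fix x assume x: "x \<in> ?S"
  let ?l = "2 powi (- j) :: real"
  have l: "?l > 0" by simp
  have "x = ?l *\<^sub>R ((inverse ?l *\<^sub>R x - (\<chi> i. of_int (k $ i))) + (\<chi> i. of_int (k $ i)))"
    using l by (simp add: scaleR_right_diff_distrib)
  moreover have "0 \<le> (inverse ?l *\<^sub>R x - (\<chi> i. of_int (k $ i))) $ i \<and> (inverse ?l *\<^sub>R x - (\<chi> i. of_int (k $ i))) $ i < 1" for i
  proof -
    have "?l * of_int (k $ i) \<le> x $ i" "x $ i < ?l * (of_int (k $ i) + 1)" using x by auto
    then show ?thesis using l by (simp add: field_simps del: power_int_minus)
  qed
  ultimately show "x \<in> dyadic_cube j k" unfolding dyadic_cube_def by blast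
qed

lemma dyadic_cube_borel [measurable]: "dyadic_cube j k \<in> sets borel"
  unfolding dyadic_cube_eq by (rule sets_borel_vec_prod) auto

lemma emeasure_dyadic_cube:
  "emeasure lborel (dyadic_cube j (k :: int ^ 'd)) = ennreal ((2 powi (- j)) ^ CARD('d))"
proof -
  have "2 powi (- j) * (of_int (k $ i) + 1) - 2 powi (- j) * of_int (k $ i) = (2 powi (- j) :: real)" for i
    by (simp add: algebra_simps)
  moreover have "2 powi (- j) * of_int (k $ i) \<le> 2 powi (- j) * (of_int (k $ i) + 1 :: real)" for i
    by (intro mult_left_mono) auto
  ultimately show ?thesis
    unfolding dyadic_cube_eq by (subst emeasure_lborel_vec_prod) (auto simp: ennreal_power simp del: power_int_minus)
qed

lemma measure_dyadic_cube:
  "measure lebesgue (dyadic_cube j (k :: int ^ 'd)) = (2 powi (- j)) ^ CARD('d)"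
  using emeasure_dyadic_cube[of j k] by (simp add: measure_def measure_completion)


lemma dyadic_cube_lebesgue: "dyadic_cube j k \<in> sets lebesgue"
  by (intro sets_completionI_sets) (simp add: dyadic_cube_borel)

lemma emeasure_vec_comb:
  assumes "0 < s" "s \<le> r" "0 \<le> N"
  shows "emeasure lborel {x :: real ^ 'd. \<forall>i. x $ i \<in> comb s r N} = ennreal ((of_int N * s) ^ CARD('d))"
  using assms by (subst emeasure_lborel_vec_prod) (auto simp: emeasure_comb ennreal_power)

text \<open>Grid and cube are both products, so their intersection is measured coordinate by
  coordinate and a one-dimensional bound suffices.\<close>

lemma emeasure_vec_comb_dyadic_cube_le:
  assumes "\<And>k. emeasure lborel (comb s r N \<inter> {2 powi (- j) * of_int k ..< 2 powi (- j) * (of_int k + 1)}) \<le> ennreal \<rho>"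
    and "0 \<le> \<rho>"
  shows "emeasure lborel ({x :: real ^ 'd. \<forall>i. x $ i \<in> comb s r N} \<inter> dyadic_cube j k) \<le> ennreal (\<rho> ^ CARD('d))"
proof -
  have "{x :: real ^ 'd. \<forall>i. x $ i \<in> comb s r N} \<inter> dyadic_cube j k =
     {x. \<forall>i. x $ i \<in> comb s r N \<inter> {2 powi (- j) * of_int (k $ i) ..< 2 powi (- j) * (of_int (k $ i) + 1)}}"
    unfolding dyadic_cube_eq by auto
  also have "emeasure lborel \<dots> = (\<Prod>i\<in>UNIV. emeasure lborel
      (comb s r N \<inter> {2 powi (- j) * of_int (k $ i) ..< 2 powi (- j) * (of_int (k $ i) + 1)}))"
    by (rule emeasure_lborel_vec_prod) auto
  also have "\<dots> \<le> (\<Prod>i\<in>(UNIV::'d set). ennreal \<rho>)"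
    by (intro prod_mono_ennreal assms)
  also have "\<dots> = ennreal (\<rho> ^ CARD('d))"
    using assms by (simp add: ennreal_power)
  finally show ?thesis .
qed

section \<open>Test functions and the general lower bound for the growth envelope\<close>

lemma G_classD:
  assumes "\<phi> \<in> G_class d p"
  shows "0 < t \<Longrightarrow> 0 < \<phi> t" "0 < s \<Longrightarrow> s \<le> t \<Longrightarrow> \<phi> s \<le> \<phi> t"
    "0 < s \<Longrightarrow> s \<le> t \<Longrightarrow> \<phi> t * t powr (- real d / p) \<le> \<phi> s * s powr (- real d / p)"
  using assms unfolding G_class_def by (auto simp: monotone_on_def)

text \<open>For a level \<open>\<sigma> < h\<close> the superlevel set is exactly \<open>A\<close>,
  which is too large for \<open>\<sigma>\<close> to be admissible in the infimum.\<close>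

lemma decr_rearrangement_ge:
  assumes h: "0 < h" and A: "A \<in> sets lebesgue" "ennreal t < emeasure lebesgue A"
  shows "ennreal h \<le> decr_rearrangement (\<lambda>x. complex_of_real (h * indicator A x)) t"
  unfolding decr_rearrangement_def
proof (intro INF_greatest)
  fix \<sigma> assume \<sigma>: "\<sigma> \<in> {\<sigma>. \<sigma> > 0 \<and> emeasure lebesgue {x. norm (complex_of_real (h * indicator A x)) > \<sigma>} \<le> ennreal t}"
  have "h \<le> \<sigma>"
  proof (rule ccontr)
    assume "\<not> h \<le> \<sigma>"
    then have "{x. norm (complex_of_real (h * indicator A x)) > \<sigma>} = A"
      using h \<sigma> by (auto simp: indicator_def abs_mult norm_mult split: if_splits)
    with \<sigma> A show False by auto
  qed
  then show "ennreal h \<le> ennreal \<sigma>" by (rule ennreal_leI)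
qed

lemma indicator_Lp_loc:
  fixes A :: "(real ^ 'd) set"
  assumes A: "A \<in> sets lebesgue"
  shows "(\<lambda>x. complex_of_real (h * indicator A x)) \<in> Lp_loc p"
proof -
  have "set_integrable lebesgue K (\<lambda>x. norm (complex_of_real (h * indicator A x)) powr p)"
    if "compact K" for K :: "(real ^ 'd) set"
  proof -
    have "K \<inter> A \<in> lmeasurable"
      using that A by (intro fmeasurable_Int_fmeasurable lmeasurable_compact)
    then have "integrable lebesgue (\<lambda>x. \<bar>h\<bar> powr p * indicator (K \<inter> A) x)"
      by (intro integrable_mult_right integrable_real_indicator) (auto simp: fmeasurable_def)
    also have "(\<lambda>x. \<bar>h\<bar> powr p * indicator (K \<inter> A) x) =
        (\<lambda>x. indicator K x *\<^sub>R (norm (complex_of_real (h * indicator A x)) powr p))"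
      by (auto simp: indicator_def)
    finally show ?thesis unfolding set_integrable_def .
  qed
  then show ?thesis using A unfolding Lp_loc_def by auto
qed

text \<open>Over a cube of side \<open>l\<close> the mean of the \<open>p\<close>-th power is at
  most \<open>h powr p * (\<rho> / l) ^ d\<close>. Here \<open>\<rho>\<close> may depend on the
  scale \<open>j\<close> but not on the position \<open>k\<close>.\<close>

lemma morrey_norm_indicator_le:
  fixes A :: "(real ^ 'd) set"
  assumes p: "0 < p" and h: "0 < h" and A: "A \<in> sets borel"
    and \<phi>: "\<And>t. 0 < t \<Longrightarrow> 0 < \<phi> t"
    and bd: "\<And>j. \<exists>\<rho>>0. (\<forall>k. emeasure lborel (A \<inter> dyadic_cube j k) \<le> ennreal (\<rho> ^ CARD('d))) \<and>
       h * \<phi> (2 powi (- j)) * (\<rho> / 2 powi (- j)) powr (CARD('d) / p) \<le> 1"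
  shows "morrey_norm \<phi> p (\<lambda>x. complex_of_real (h * indicator A x)) \<le> 1"
  unfolding morrey_norm_def
proof (intro SUP_least, clarify)
  fix j :: int and k :: "int ^ 'd"
  define l :: real where "l = 2 powi (- j)"
  have l: "0 < l" by (simp add: l_def)
  obtain \<rho> where \<rho>: "\<rho> > 0" "emeasure lborel (A \<inter> dyadic_cube j k) \<le> ennreal (\<rho> ^ CARD('d))"
    "h * \<phi> l * (\<rho> / l) powr (CARD('d) / p) \<le> 1"
    using bd[of j] unfolding l_def by blast
  have "(LINT y : dyadic_cube j k | lebesgue. norm (complex_of_real (h * indicator A y)) powr p)
     = (LINT y | lebesgue. h powr p * indicator (A \<inter> dyadic_cube j k) y)"
    unfolding set_lebesgue_integral_def using h
    by (intro Bochner_Integration.integral_cong) (auto simp: indicator_def)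
  also have "\<dots> = h powr p * measure lborel (A \<inter> dyadic_cube j k)"
    using A by simp
  also have "\<dots> \<le> h powr p * \<rho> ^ CARD('d)"
    using \<rho> by (intro mult_left_mono) (auto simp: measure_def enn2real_leI)
  finally have I: "(LINT y : dyadic_cube j k | lebesgue. norm (complex_of_real (h * indicator A y)) powr p)
     \<le> h powr p * \<rho> ^ CARD('d)" .
  have "(1 / measure lebesgue (dyadic_cube j k) *
         (LINT y : dyadic_cube j k | lebesgue. norm (complex_of_real (h * indicator A y)) powr p)) powr (1 / p)
      \<le> (1 / l ^ CARD('d) * (h powr p * \<rho> ^ CARD('d))) powr (1 / p)"
    unfolding measure_dyadic_cube l_def[symmetric]
    using I p l by (intro powr_mono2 mult_left_mono mult_nonneg_nonneg) (auto simp: set_lebesgue_integral_def)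
  also have "1 / l ^ CARD('d) * (h powr p * \<rho> ^ CARD('d)) = h powr p * (\<rho> / l) powr CARD('d)"
    using l \<rho> by (simp add: powr_realpow power_divide)
  also have "\<dots> powr (1 / p) = h * (\<rho> / l) powr (CARD('d) / p)"
    using h p l \<rho> by (simp add: powr_mult powr_powr)
  finally have "\<phi> l * (1 / measure lebesgue (dyadic_cube j k) *
         (LINT y : dyadic_cube j k | lebesgue. norm (complex_of_real (h * indicator A y)) powr p)) powr (1 / p)
      \<le> \<phi> l * (h * (\<rho> / l) powr (CARD('d) / p))"
    using \<phi>[OF l] by (intro mult_left_mono) auto
  also have "\<dots> \<le> 1" using \<rho>(3) by (simp add: mult_ac)
  finally show "ennreal (\<phi> (2 powi (- j)) * (1 / measure lebesgue (dyadic_cube j k) *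
         (LINT y : dyadic_cube j k | lebesgue. norm (complex_of_real (h * indicator A y)) powr p)) powr (1 / p)) \<le> 1"
    unfolding l_def by (simp add: ennreal_le_1 del: power_int_minus)
qed

text \<open>Assumption \<open>hL\<close> is the Morrey condition on cubes of side
  \<open>2 powi a\<close>, and \<open>t\<close> is less than the measure
  \<open>(2 powi b) ^ d\<close> of the grid. The condition on cubes as small as a tooth is met by
  shrinking the teeth, using \<open>lim\<close>.\<close>

lemma growth_envelope_ge:
  fixes a b :: int
  assumes p: "0 < p" and G: "\<phi> \<in> G_class CARD('d) p" and lim: "(\<phi> \<longlongrightarrow> 0) (at_right 0)"
    and ba: "b \<le> a" and h: "0 < h"
    and hL: "h * \<phi> (2 powi a) * (2 powi (b - a)) powr (CARD('d) / p) \<le> 1"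
    and t: "t < (2 powi b) ^ CARD('d)"
  shows "ennreal h \<le> growth_envelope (morrey_space \<phi> p :: (real ^ 'd \<Rightarrow> complex) set) (morrey_norm \<phi> p) t"
proof -
  define \<kappa> where "\<kappa> = CARD('d) / p"
  have pw: "u powr (- real CARD('d) / p) = u powr (- \<kappa>)" for u by (simp add: \<kappa>_def)
  note \<phi>0 = G_classD(1)[OF G] and mono = G_classD(2)[OF G] and anti = G_classD(3)[OF G, unfolded pw]
  \<comment> \<open>\<open>2 powi e\<close> will be the side of a tooth; \<open>e \<le> b\<close>
    makes the number \<open>2 powi (b - e)\<close> of teeth per axis an integer.\<close>
  obtain e :: int where e: "e \<le> b" "h * \<phi> (2 powi e) \<le> 1"
  proof -
    have "eventually (\<lambda>x. \<phi> x < 1 / h) (at_right 0)"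
      using order_tendstoD(2)[OF lim, of "1 / h"] h by simp
    then obtain \<epsilon> where \<epsilon>: "\<epsilon> > 0" "\<And>x. 0 < x \<Longrightarrow> x < \<epsilon> \<Longrightarrow> \<phi> x < 1 / h"
      unfolding eventually_at_right_field by auto
    obtain n where n: "(1 / 2 :: real) ^ n < \<epsilon>" using real_arch_pow_inv[of \<epsilon> "1/2"] \<epsilon> by auto
    define e where "e = min b (- int n)"
    have "(2::real) powi e \<le> 2 powi (- int n)" unfolding e_def by (intro power_int_increasing) auto
    also have "\<dots> < \<epsilon>" using n by (simp add: power_int_minus power_divide inverse_eq_divide)
    finally have "\<phi> (2 powi e) < 1 / h" by (intro \<epsilon>) auto
    then have "h * \<phi> (2 powi e) \<le> 1" using h by (simp add: field_simps)
    then show ?thesis using that[of e] by (simp add: e_def)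
  qed
  \<comment> \<open>These choices give \<open>N * s = 2 powi b\<close>, the total length of the
    teeth, and \<open>N * r = 2 powi a\<close>, the length of all periods together.\<close>
  define s r :: real where "s = 2 powi e" and "r = 2 powi (a - b + e)"
  define N :: int where "N = 2 ^ nat (b - e)"
  have s: "0 < s" "s \<le> r" unfolding s_def r_def using ba by (auto intro!: power_int_increasing)
  have Ns: "of_int N * s = 2 powi b"
    using e by (simp add: N_def s_def flip: power_int_add power_int_of_nat)
  have N: "0 \<le> N" by (simp add: N_def)
  define A where "A = {x :: real ^ 'd. \<forall>i. x $ i \<in> comb s r N}"
  have A: "A \<in> sets borel" unfolding A_def by (intro sets_borel_vec_prod) auto
  then have A': "A \<in> sets lebesgue" by (intro sets_completionI_sets) auto
  have "morrey_norm \<phi> p (\<lambda>x. complex_of_real (h * indicator A x)) \<le> 1"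
  proof (rule morrey_norm_indicator_le[OF p h A \<phi>0])
    fix j :: int
    define l :: real where "l = 2 powi (- j)"
    have l: "0 < l" by (simp add: l_def)
    let ?I = "\<lambda>k. {l * of_int k ..< l * (of_int k + 1)}"
    have "\<exists>\<rho>>0. (\<forall>k. emeasure lborel (comb s r N \<inter> ?I k) \<le> ennreal \<rho>) \<and> h * \<phi> l * (\<rho> / l) powr \<kappa> \<le> 1"
    proof -
      \<comment> \<open>The side \<open>l\<close> is compared with
        \<open>s \<le> r \<le> 2 powi a\<close>. From the first case to the last,
        \<open>\<rho>\<close> is \<open>2 powi b\<close>, \<open>l * s / r\<close>, \<open>s\<close>
        and \<open>l\<close>. In cases 1 and 3 antimonotonicity of
        \<open>\<phi> t * t powr (- \<kappa>)\<close> reduces the estimate to side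
        \<open>2 powi a\<close> or \<open>s\<close>; in cases 2 and 4 monotonicity of
        \<open>\<phi>\<close> does.\<close>
      consider "a \<le> - j" | "a - b + e \<le> - j" "- j < a" | "e \<le> - j" "- j < a - b + e" | "- j < e" by linarith
      then show ?thesis
      proof cases
        case 1
        have "emeasure lborel (comb s r N \<inter> ?I k) \<le> ennreal (2 powi b)" for k
          using emeasure_comb[OF s N] Ns by (metis comb_borel emeasure_mono inf_le1 sets_lborel)
        moreover have "h * \<phi> l * (2 powi b / l) powr \<kappa> \<le> 1"
        proof -
          have "\<phi> l * l powr (- \<kappa>) \<le> \<phi> (2 powi a) * (2 powi a) powr (- \<kappa>)"
            using 1 unfolding l_def by (intro anti power_int_increasing) auto
          then have "h * (2 powi b) powr \<kappa> * (\<phi> l * l powr (- \<kappa>)) \<le> h * (2 powi b) powr \<kappa> * (\<phi> (2 powi a) * (2 powi a) powr (- \<kappa>))"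
            using h by (intro mult_left_mono) auto
          also have "\<dots> = h * \<phi> (2 powi a) * (2 powi (b - a)) powr \<kappa>"
            by (simp add: power_int_diff powr_divide powr_minus field_simps)
          also have "\<dots> \<le> 1" using hL by (simp add: \<kappa>_def)
          finally show ?thesis using l by (simp add: powr_divide powr_minus field_simps)
        qed
        ultimately show ?thesis by (intro exI[of _ "2 powi b"]) auto
      next
        case 2
        have "l = 2 ^ nat (- j - (a - b + e)) * r"
          using 2 by (simp add: l_def r_def flip: power_int_add power_int_of_nat)
        note emeasure_comb_coarse[OF s this, of N]
        moreover have "s / r = 2 powi (b - a)" by (simp add: s_def r_def flip: power_int_diff)
        moreover have "\<phi> l \<le> \<phi> (2 powi a)" using 2 unfolding l_def by (intro mono power_int_increasing) auto
        then have "h * \<phi> l * (2 powi (b - a)) powr \<kappa> \<le> h * \<phi> (2 powi a) * (2 powi (b - a)) powr \<kappa>"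
          using h by (intro mult_left_mono mult_right_mono) auto
        ultimately show ?thesis using hL l s
          by (intro exI[of _ "l * s / r"]) (auto simp: \<kappa>_def)
      next
        case 3
        have "r = 2 ^ nat (a - b + e + j) * l"
          using 3 by (simp add: l_def r_def flip: power_int_add power_int_of_nat)
        note emeasure_comb_fine[OF s this, of N]
        moreover have "h * \<phi> l * (s / l) powr \<kappa> \<le> 1"
        proof -
          have "\<phi> l * l powr (- \<kappa>) \<le> \<phi> s * s powr (- \<kappa>)"
            using 3 unfolding l_def s_def by (intro anti power_int_increasing) auto
          then have "h * s powr \<kappa> * (\<phi> l * l powr (- \<kappa>)) \<le> h * s powr \<kappa> * (\<phi> s * s powr (- \<kappa>))"
            using h by (intro mult_left_mono) auto
          also have "\<dots> = h * \<phi> s" using s by (simp add: powr_minus)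
          also have "\<dots> \<le> 1" using e by (simp add: s_def)
          finally show ?thesis using l s by (simp add: powr_divide powr_minus field_simps)
        qed
        ultimately show ?thesis using s by (intro exI[of _ s]) auto
      next
        case 4
        have "emeasure lborel (comb s r N \<inter> ?I k) \<le> emeasure lborel (?I k)" for k
          by (intro emeasure_mono) auto
        also have "emeasure lborel (?I k) = ennreal l" for k
          using l by (subst emeasure_lborel_Ico) (auto simp: algebra_simps)
        finally have "emeasure lborel (comb s r N \<inter> ?I k) \<le> ennreal l" for k .
        moreover have "\<phi> l \<le> \<phi> (2 powi e)" using 4 unfolding l_def by (intro mono power_int_increasing) auto
        then have "h * \<phi> l \<le> h * \<phi> (2 powi e)" using h by simp
        ultimately show ?thesis using e l by (intro exI[of _ l]) auto
      qed
    qed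
    then obtain \<rho> where \<rho>: "0 < \<rho>" "\<And>k. emeasure lborel (comb s r N \<inter> ?I k) \<le> ennreal \<rho>" "h * \<phi> l * (\<rho> / l) powr \<kappa> \<le> 1"
      by blast
    show "\<exists>\<rho>>0. (\<forall>k. emeasure lborel (A \<inter> dyadic_cube j k) \<le> ennreal (\<rho> ^ CARD('d))) \<and>
       h * \<phi> (2 powi (- j)) * (\<rho> / 2 powi (- j)) powr (CARD('d) / p) \<le> 1"
      unfolding A_def l_def[symmetric] \<kappa>_def[symmetric]
      using \<rho> emeasure_vec_comb_dyadic_cube_le[of s r N j \<rho>] unfolding l_def[symmetric] by auto
  qed
  then have mem: "(\<lambda>x. complex_of_real (h * indicator A x)) \<in> {f \<in> morrey_space \<phi> p. morrey_norm \<phi> p f \<le> 1}"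
    using indicator_Lp_loc[OF A', of h p] unfolding morrey_space_def by (auto intro: le_less_trans)
  have "emeasure lebesgue A = ennreal ((2 powi b) ^ CARD('d))"
    using A emeasure_vec_comb[OF s N, where 'd = 'd] by (simp add: Ns A_def)
  with t have "ennreal t < emeasure lebesgue A" by (simp add: ennreal_lessI)
  from decr_rearrangement_ge[OF h A' this] show ?thesis
    unfolding growth_envelope_def by (rule SUP_upper2[OF mem])
qed


section \<open>Upper bound for the growth envelope\<close>

lemma Lp_loc_integrable_dyadic_cube:
  assumes "f \<in> Lp_loc p"
  shows "set_integrable lebesgue (dyadic_cube j k) (\<lambda>x. norm (f x) powr p)"
proof (rule set_integrable_subset)
  let ?l = "2 powi (- j) :: real"
  let ?K = "cbox (\<chi> i. ?l * of_int (k $ i)) (\<chi> i. ?l * (of_int (k $ i) + 1))"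
  show "set_integrable lebesgue ?K (\<lambda>x. norm (f x) powr p)"
    using assms compact_cbox unfolding Lp_loc_def by blast
  show "dyadic_cube j k \<subseteq> ?K"
    unfolding dyadic_cube_eq by (auto simp: mem_box_cart less_imp_le)
qed (rule dyadic_cube_lebesgue)

text \<open>The factor \<open>l powr (d / p)\<close> in the lower bound for \<open>\<phi> l\<close>
  cancels the normalisation by the volume of the cube. Hence the integral \<open>J\<close> is at
  most \<open>c powr (- p)\<close> at every scale, and Markov's inequality at level
  \<open>\<sigma> powr p\<close> applies.\<close>

lemma emeasure_superlevel_dyadic_cube_le:
  fixes f :: "real ^ 'd \<Rightarrow> complex"
  assumes p: "0 < p" and c: "0 < c" and \<phi>: "\<And>t. 0 < t \<Longrightarrow> c * t powr (CARD('d) / p) \<le> \<phi> t"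
    and f: "f \<in> Lp_loc p" "morrey_norm \<phi> p f \<le> 1" and \<sigma>: "0 < \<sigma>"
  shows "emeasure lebesgue ({x. norm (f x) > \<sigma>} \<inter> dyadic_cube j k) \<le> ennreal ((c * \<sigma>) powr (- p))"
proof -
  define l :: real where "l = 2 powi (- j)"
  have l: "0 < l" by (simp add: l_def)
  let ?Q = "dyadic_cube j k"
  define J where "J = (LINT y : ?Q | lebesgue. norm (f y) powr p)"
  have J0: "0 \<le> J" unfolding J_def set_lebesgue_integral_def by (intro Bochner_Integration.integral_nonneg) auto
  have "ennreal (\<phi> l * (1 / measure lebesgue ?Q * J) powr (1 / p)) \<le> morrey_norm \<phi> p f"
    unfolding morrey_norm_def J_def l_def by (rule SUP_upper2[of "(j, k)"]) auto
  from order_trans[OF this f(2)] have "\<phi> l * (J / l ^ CARD('d)) powr (1 / p) \<le> 1"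
    unfolding measure_dyadic_cube l_def[symmetric] by (simp add: ennreal_le_1)
  moreover have "c * l powr (CARD('d) / p) * (J / l ^ CARD('d)) powr (1 / p) \<le> \<phi> l * (J / l ^ CARD('d)) powr (1 / p)"
    using \<phi>[OF l] by (intro mult_right_mono) auto
  moreover have "l powr (CARD('d) / p) * (J / l ^ CARD('d)) powr (1 / p) = J powr (1 / p)"
  proof -
    have "l ^ CARD('d) = l powr CARD('d)" using l by (simp add: powr_realpow)
    then show ?thesis using l J0 by (simp add: powr_divide powr_powr)
  qed
  ultimately have "c * J powr (1 / p) \<le> 1" by (simp add: mult.assoc)
  then have "(c * J powr (1 / p)) powr p \<le> 1 powr p" using p c by (intro powr_mono2) auto
  then have J1: "J \<le> c powr (- p)" using p c J0 by (simp add: powr_mult powr_powr powr_minus field_simps)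
  let ?g = "\<lambda>x. indicator ?Q x *\<^sub>R (norm (f x) powr p)"
  \<comment> \<open>Membership of \<open>f\<close> in \<open>Lp_loc p\<close> ensures that
    \<open>J\<close> is a genuine integral and not the default value \<open>0\<close>.\<close>
  have g: "integrable lebesgue ?g"
    using Lp_loc_integrable_dyadic_cube[OF f(1)] unfolding set_integrable_def .
  have "emeasure lebesgue ({x. norm (f x) > \<sigma>} \<inter> ?Q) \<le> emeasure lebesgue {x \<in> space lebesgue. \<sigma> powr p \<le> ?g x}"
  proof (rule emeasure_mono)
    show "{x. norm (f x) > \<sigma>} \<inter> ?Q \<subseteq> {x \<in> space lebesgue. \<sigma> powr p \<le> ?g x}"
      using \<sigma> p by (auto intro!: powr_mono2)
    show "{x \<in> space lebesgue. \<sigma> powr p \<le> ?g x} \<in> sets lebesgue"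
      using borel_measurable_integrable[OF g] by measurable
  qed
  also have "\<dots> \<le> ennreal (1 / \<sigma> powr p * (\<integral>x. ?g x \<partial>lebesgue))"
    using \<sigma> by (intro integral_Markov_inequality g) auto
  also have "\<dots> \<le> ennreal ((c * \<sigma>) powr (- p))"
  proof (rule ennreal_leI)
    have "1 / \<sigma> powr p * J \<le> 1 / \<sigma> powr p * c powr (- p)" using J1 by (intro mult_left_mono) auto
    also have "\<dots> = (c * \<sigma>) powr (- p)" using c \<sigma> by (simp add: powr_mult powr_minus field_simps)
    finally show "1 / \<sigma> powr p * (\<integral>x. ?g x \<partial>lebesgue) \<le> (c * \<sigma>) powr (- p)"
      unfolding J_def set_lebesgue_integral_def .
  qed
  finally show ?thesis .
qed

text \<open>Dyadic cubes never cross a coordinate hyperplane, so one increasing sequence of them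
  fills at most an orthant. The box with coordinates in \<open>[-2 ^ n, 2 ^ n)\<close> is covered by
  one cube of side \<open>2 ^ n\<close> per orthant; \<open>M\<close> is the number of orthants, and
  the bound passes to the limit by continuity from below.\<close>

lemma emeasure_le_dyadic_bound:
  obtains M :: real where "0 < M"
    "\<And>(S :: (real ^ 'd) set) B. S \<in> sets lebesgue \<Longrightarrow> 0 \<le> B \<Longrightarrow> (\<And>j k. emeasure lebesgue (S \<inter> dyadic_cube j k) \<le> ennreal B)
      \<Longrightarrow> emeasure lebesgue S \<le> ennreal (M * B)"
proof -
  define K where "K = range (\<lambda>Z :: 'd set. (\<chi> i. if i \<in> Z then - 1 else 0) :: int ^ 'd)"
  have K: "finite K" "K \<noteq> {}" by (auto simp: K_def)
  define box where "box n = {x :: real ^ 'd. \<forall>i. x $ i \<in> {- (2 ^ n) ..< 2 ^ n}}" for n :: nat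
  have box_sub: "box n \<subseteq> (\<Union>k\<in>K. dyadic_cube (- int n) k)" for n
  proof
    fix x assume x: "x \<in> box n"
    \<comment> \<open>The negative coordinates of \<open>x\<close> get index \<open>-1\<close>, that
      is, the interval \<open>[-2 ^ n, 0)\<close>; the scale \<open>- int n\<close> stands for side
      \<open>2 ^ n\<close>.\<close>
    let ?k = "(\<chi> i. if i \<in> {i. x $ i < 0} then - 1 else 0) :: int ^ 'd"
    have "x \<in> dyadic_cube (- int n) ?k"
      using x unfolding dyadic_cube_eq box_def by (auto simp: power_int_def)
    moreover have "?k \<in> K" unfolding K_def by blast
    ultimately show "x \<in> (\<Union>k\<in>K. dyadic_cube (- int n) k)" by blast
  qed
  have box: "box n \<in> sets lebesgue" for n
    unfolding box_def by (intro sets_completionI_sets) (simp add: sets_borel_vec_prod)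
  have "emeasure lebesgue S \<le> ennreal (card K * B)"
    if S: "S \<in> sets lebesgue" and B: "0 \<le> B" "\<And>j k. emeasure lebesgue (S \<inter> dyadic_cube j k) \<le> ennreal B"
    for S :: "(real ^ 'd) set" and B :: real
  proof -
    have un: "(\<Union>n. S \<inter> box n) = S"
    proof (intro equalityI subsetI)
      fix x assume "x \<in> S"
      obtain n where n: "norm x < 2 ^ n" using real_arch_pow[of 2 "norm x"] by auto
      have "\<bar>x $ i\<bar> < 2 ^ n" for i using component_le_norm_cart[of x i] n by linarith
      then have "x \<in> box n" unfolding box_def by (auto simp: abs_less_iff less_imp_le minus_less_iff)
      with \<open>x \<in> S\<close> show "x \<in> (\<Union>n. S \<inter> box n)" by blast
    qed auto
    have "incseq (\<lambda>n. S \<inter> box n)"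
    proof (rule incseq_SucI)
      fix n
      have "(2::real) ^ n \<le> 2 ^ Suc n" by simp
      then show "S \<inter> box n \<le> S \<inter> box (Suc n)" unfolding box_def atLeastLessThan_iff
        by (smt (verit) IntE IntI mem_Collect_eq subsetI)
    qed
    then have "emeasure lebesgue S = (SUP n. emeasure lebesgue (S \<inter> box n))"
      using S box by (subst SUP_emeasure_incseq) (auto simp only: un intro!: sets.Int)
    also have "\<dots> \<le> ennreal (card K * B)"
    proof (rule SUP_least)
      fix n
      have "emeasure lebesgue (S \<inter> box n) \<le> emeasure lebesgue (\<Union>k\<in>K. S \<inter> dyadic_cube (- int n) k)"
        using box_sub[of n] S K dyadic_cube_lebesgue by (intro emeasure_mono sets.finite_UN sets.Int) auto
      also have "\<dots> \<le> (\<Sum>k\<in>K. emeasure lebesgue (S \<inter> dyadic_cube (- int n) k))"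
        using S K dyadic_cube_lebesgue by (intro emeasure_subadditive_finite) auto
      also have "\<dots> \<le> (\<Sum>k\<in>K. ennreal B)" by (intro sum_mono B)
      also have "\<dots> = ennreal (card K * B)"
        using B by (simp add: ennreal_of_nat_eq_real_of_nat ennreal_mult)
      finally show "emeasure lebesgue (S \<inter> box n) \<le> ennreal (card K * B)" .
    qed
    finally show ?thesis .
  qed
  moreover have "0 < real (card K)" using K by (simp add: card_gt_0_iff)
  ultimately show ?thesis using that[of "real (card K)"] by blast
qed

lemma growth_envelope_le:
  assumes p: "0 < p" and c: "0 < c" and \<phi>: "\<And>t. 0 < t \<Longrightarrow> c * t powr (CARD('d) / p) \<le> \<phi> t"
  obtains C :: real where "0 < C"
    "\<And>t. 0 < t \<Longrightarrow> growth_envelope (morrey_space \<phi> p :: (real ^ 'd \<Rightarrow> complex) set) (morrey_norm \<phi> p) t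
       \<le> ennreal (C * t powr (- 1 / p))"
proof -
  obtain M where M: "0 < M" "\<And>(S :: (real ^ 'd) set) B. S \<in> sets lebesgue \<Longrightarrow> 0 \<le> B \<Longrightarrow>
      (\<And>j k. emeasure lebesgue (S \<inter> dyadic_cube j k) \<le> ennreal B) \<Longrightarrow> emeasure lebesgue S \<le> ennreal (M * B)"
    using emeasure_le_dyadic_bound by blast
  \<comment> \<open>Chosen so that the bound \<open>M * (c * \<sigma>) powr (- p)\<close> equals
    \<open>t\<close> at \<open>\<sigma> = C * t powr (- 1 / p)\<close>, which makes this
    \<open>\<sigma>\<close> admissible in the rearrangement at \<open>t\<close>.\<close>
  define C where "C = M powr (1 / p) / c"
  have C: "0 < C" using M c by (simp add: C_def)
  have "growth_envelope (morrey_space \<phi> p :: (real ^ 'd \<Rightarrow> complex) set) (morrey_norm \<phi> p) t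
       \<le> ennreal (C * t powr (- 1 / p))" if t: "0 < t" for t
    unfolding growth_envelope_def
  proof (rule SUP_least)
    fix f :: "real ^ 'd \<Rightarrow> complex"
    assume "f \<in> {f \<in> morrey_space \<phi> p. morrey_norm \<phi> p f \<le> 1}"
    then have f: "f \<in> Lp_loc p" "morrey_norm \<phi> p f \<le> 1" by (auto simp: morrey_space_def)
    define \<sigma> where "\<sigma> = C * t powr (- 1 / p)"
    have \<sigma>: "0 < \<sigma>" using C t by (simp add: \<sigma>_def)
    have "f \<in> borel_measurable lebesgue" using f by (simp add: Lp_loc_def)
    then have "(\<lambda>x. norm (f x)) \<in> borel_measurable lebesgue" by measurable
    then have "{x \<in> space lebesgue. norm (f x) > \<sigma>} \<in> sets lebesgue" by measurable
    then have S: "{x. norm (f x) > \<sigma>} \<in> sets lebesgue" by simp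
    have "emeasure lebesgue {x. norm (f x) > \<sigma>} \<le> ennreal (M * (c * \<sigma>) powr (- p))"
      by (rule M(2)[OF S]) (auto intro: emeasure_superlevel_dyadic_cube_le[OF p c \<phi> f \<sigma>])
    also have "c * \<sigma> = (M / t) powr (1 / p)"
      using c M t by (simp add: \<sigma>_def C_def powr_divide powr_minus field_simps)
    also have "M * \<dots> powr (- p) = t"
      using p M t by (simp add: powr_powr powr_minus)
    finally show "decr_rearrangement f t \<le> ennreal (C * t powr (- 1 / p))"
      unfolding decr_rearrangement_def \<sigma>_def[symmetric] using \<sigma> by (intro INF_lower) auto
  qed
  with C show ?thesis by (rule that)
qed

section \<open>The lower bounds in the two cases and the conclusion\<close>

text \<open>The measure of the grid is fixed by \<open>t\<close>, while the side
  \<open>2 ^ N\<close> of the surrounding cube grows. By \<open>lim\<close> the Morrey condition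
  then tolerates any prescribed height \<open>h\<close>.\<close>

lemma growth_envelope_eq_top:
  assumes p: "0 < p" and G: "\<phi> \<in> G_class CARD('d) p" and lim0: "(\<phi> \<longlongrightarrow> 0) (at_right 0)"
    and lim: "((\<lambda>t. t powr (- real CARD('d) / p) * \<phi> t) \<longlongrightarrow> 0) at_top"
  shows "growth_envelope (morrey_space \<phi> p :: (real ^ 'd \<Rightarrow> complex) set) (morrey_norm \<phi> p) t = \<infinity>"
proof -
  let ?E = "growth_envelope (morrey_space \<phi> p :: (real ^ 'd \<Rightarrow> complex) set) (morrey_norm \<phi> p) t"
  have ge: "ennreal h \<le> ?E" if h: "0 < h" for h
  proof -
    obtain n where "t < 2 ^ n" using real_arch_pow[of 2 t] by auto
    also have "(2::real) ^ n \<le> (2 ^ n) ^ CARD('d)" by (intro self_le_power) auto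
    finally have tb: "t < (2 powi int n) ^ CARD('d)" by simp
    define B where "B = (2 ^ n) powr (CARD('d) / p)"
    have B: "0 < B" by (simp add: B_def)
    have "eventually (\<lambda>x. x powr (- real CARD('d) / p) * \<phi> x < 1 / (h * B)) at_top"
      using order_tendstoD(2)[OF lim, of "1 / (h * B)"] h B by simp
    then obtain X where X: "\<And>x. X \<le> x \<Longrightarrow> x powr (- real CARD('d) / p) * \<phi> x < 1 / (h * B)"
      by (auto simp: eventually_at_top_linorder)
    obtain m where m: "X < 2 ^ m" using real_arch_pow[of 2 X] by auto
    \<comment> \<open>\<open>m\<close> makes the limit effective, and \<open>n\<close> ensures that
      the grid fits, as \<open>b \<le> a\<close> demands.\<close>
    define N where "N = max m n"
    have "X \<le> 2 ^ N" using m power_increasing[of m N "2::real"] unfolding N_def by linarith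
    from X[OF this] have "h * (B * (2 ^ N) powr (- real CARD('d) / p) * \<phi> (2 ^ N)) \<le> 1"
      using h B by (simp add: field_simps)
    moreover have "(2 powi (int n - int N)) powr (CARD('d) / p) = B * (2 ^ N) powr (- real CARD('d) / p)"
      unfolding B_def by (subst power_int_diff) (simp_all add: powr_divide powr_minus_divide)
    ultimately have "h * \<phi> (2 powi int N) * (2 powi (int n - int N)) powr (CARD('d) / p) \<le> 1"
      by (simp add: mult_ac)
    then show ?thesis by (intro growth_envelope_ge[OF p G lim0 _ h _ tb, where a = "int N"]) (auto simp: N_def)
  qed
  show ?thesis
  proof (cases ?E)
    case (real r)
    with ge[of "r + 1"] show ?thesis by simp
  qed simp
qed

lemma growth_envelope_ge_powr:
  assumes p: "0 < p" and G: "\<phi> \<in> G_class CARD('d) p" and lim0: "(\<phi> \<longlongrightarrow> 0) (at_right 0)"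
    and one: "\<phi> 1 = 1" and t: "0 < t"
  shows "ennreal (2 powr (- real CARD('d) / p) * t powr (- 1 / p)) \<le>
    growth_envelope (morrey_space \<phi> p :: (real ^ 'd \<Rightarrow> complex) set) (morrey_norm \<phi> p) t"
proof -
  define \<kappa> where "\<kappa> = CARD('d) / p"
  have \<kappa>: "0 < \<kappa>" using p by (simp add: \<kappa>_def)
  define u where "u = t powr (1 / CARD('d))"
  have u: "0 < u" using t by (simp add: u_def)
  \<comment> \<open>The least integer with \<open>u < 2 powi b\<close>. The inequality must be
    strict to give \<open>t < (2 powi b) ^ d\<close>; the loss \<open>2 powi b \<le> 2 * u\<close>
    produces the constant \<open>2 powr (- d / p)\<close>.\<close>
  define b where "b = \<lfloor>log 2 u\<rfloor> + 1"
  have "of_int b - 1 \<le> log 2 u" "log 2 u < of_int b" unfolding b_def by linarith+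
  then have "2 powr (of_int b - 1) \<le> u" and "u < 2 powr of_int b"
    using u by (simp_all add: le_log_iff log_less_iff)
  then have b: "2 powi b \<le> 2 * u" "u < 2 powi b"
    by (simp_all add: powr_diff powr_real_of_int')
  have "t = u ^ CARD('d)" using t u by (simp add: u_def powr_powr flip: powr_realpow)
  also have "\<dots> < (2 powi b) ^ CARD('d)" using b u by (intro power_strict_mono) auto
  finally have tb: "t < (2 powi b) ^ CARD('d)" .
  \<comment> \<open>The normalisation \<open>\<phi> 1 = 1\<close> yields
    \<open>\<phi> L \<le> L powr \<kappa>\<close> for \<open>L \<ge> 1\<close>, hence the cube is
    taken with side at least \<open>1\<close> even when \<open>b\<close> is negative.\<close>
  define a where "a = max b 0"
  have a1: "(1::real) \<le> 2 powi a" unfolding a_def by simp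
  define h where "h = (2 powi b :: real) powr (- \<kappa>)"
  have "\<phi> (2 powi a) * (2 powi a) powr (- \<kappa>) \<le> 1"
    using G_classD(3)[OF G, of 1 "2 powi a"] a1 one by (simp add: \<kappa>_def)
  moreover have "h * \<phi> (2 powi a) * (2 powi (b - a)) powr \<kappa> = \<phi> (2 powi a) * (2 powi a) powr (- \<kappa>)"
    by (simp add: h_def power_int_diff powr_divide powr_minus field_simps)
  ultimately have "h * \<phi> (2 powi a) * (2 powi (b - a)) powr (CARD('d) / p) \<le> 1"
    unfolding \<kappa>_def by linarith
  then have "ennreal h \<le> growth_envelope (morrey_space \<phi> p :: (real ^ 'd \<Rightarrow> complex) set) (morrey_norm \<phi> p) t"
    by (intro growth_envelope_ge[OF p G lim0 _ _ _ tb, of a]) (auto simp: a_def h_def)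
  moreover have "2 powr (- real CARD('d) / p) * t powr (- 1 / p) \<le> h"
  proof -
    have "(2 * u) powr (- \<kappa>) \<le> h" unfolding h_def using b \<kappa> u by (intro powr_mono2') auto
    moreover have "(2 * u) powr (- \<kappa>) = 2 powr (- real CARD('d) / p) * t powr (- 1 / p)"
      using u t by (simp add: powr_mult \<kappa>_def u_def powr_powr)
    ultimately show ?thesis by simp
  qed
  ultimately show ?thesis by (meson ennreal_leI order_trans)
qed

theorem theorem2p17:
  fixes p :: real and \<phi> :: "real \<Rightarrow> real" and E :: "real \<Rightarrow> ennreal"
  defines "E \<equiv> growth_envelope (morrey_space \<phi> p :: (real ^ 'd \<Rightarrow> complex) set) (morrey_norm \<phi> p)"
  assumes "0 < p"
    and "\<phi> \<in> G_class CARD('d) p"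
    and "\<phi> 1 = 1"
    and "(\<phi> \<longlongrightarrow> 0) (at_right 0)"
  shows "(((\<lambda>t. t powr (- real CARD('d) / p) * \<phi> t) \<longlongrightarrow> 0) at_top \<longrightarrow> (\<forall>t>0. E t = \<infinity>)) \<and>
    (\<forall>c>0. ((\<lambda>t. t powr (- real CARD('d) / p) * \<phi> t) \<longlongrightarrow> c) at_top \<longrightarrow>
       sim_on {0<..} E (\<lambda>t. ennreal (t powr (- 1 / p))))"
proof (intro conjI impI allI)
  fix t :: real
  assume "((\<lambda>t. t powr (- real CARD('d) / p) * \<phi> t) \<longlongrightarrow> 0) at_top"
  then show "E t = \<infinity>"
    unfolding E_def using assms by (intro growth_envelope_eq_top) auto
next
  fix c :: real
  assume c: "0 < c" and lim: "((\<lambda>t. t powr (- real CARD('d) / p) * \<phi> t) \<longlongrightarrow> c) at_top"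
  have "c * t powr (CARD('d) / p) \<le> \<phi> t" if t: "0 < t" for t
  proof -
    \<comment> \<open>A nonincreasing function lies above its limit at infinity.\<close>
    have "eventually (\<lambda>x. x powr (- real CARD('d) / p) * \<phi> x \<le> t powr (- real CARD('d) / p) * \<phi> t) at_top"
      using G_classD(3)[OF assms(3) t]
      by (intro eventually_mono[OF eventually_ge_at_top[of t]]) (simp add: mult.commute)
    then have "c \<le> t powr (- real CARD('d) / p) * \<phi> t"
      by (intro tendsto_upperbound[OF lim]) auto
    then show ?thesis using t by (simp add: powr_minus field_simps)
  qed
  then obtain C where C: "0 < C" "\<And>t. 0 < t \<Longrightarrow> E t \<le> ennreal (C * t powr (- 1 / p))"
    using growth_envelope_le[OF assms(2) c, where 'd = 'd and \<phi> = \<phi>] unfolding E_def by blast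
  \<comment> \<open>As \<open>E\<close> is the first argument of \<open>sim_on\<close>, the upper
    bound for \<open>E\<close> yields the left constant \<open>1 / C\<close>, and the lower bound
    yields the right constant \<open>D\<close>, the inverse of its factor.\<close>
  define D where "D = 2 powr (real CARD('d) / p)"
  have D: "0 < D" by (simp add: D_def)
  have "ennreal (1 / C) * E t \<le> ennreal (t powr (- 1 / p))" if "0 < t" for t
  proof -
    have "ennreal (1 / C) * E t \<le> ennreal (1 / C) * ennreal (C * t powr (- 1 / p))"
      using C(2)[OF that] by (intro mult_left_mono) auto
    also have "\<dots> = ennreal (t powr (- 1 / p))" using C(1) by (simp flip: ennreal_mult)
    finally show ?thesis .
  qed
  moreover have "ennreal (t powr (- 1 / p)) \<le> ennreal D * E t" if t: "0 < t" for t
  proof -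
    have "ennreal (t powr (- 1 / p)) = ennreal D * ennreal (2 powr (- real CARD('d) / p) * t powr (- 1 / p))"
      by (simp add: D_def powr_minus flip: ennreal_mult)
    also have "\<dots> \<le> ennreal D * E t"
      unfolding E_def by (intro mult_left_mono growth_envelope_ge_powr assms t) auto
    finally show ?thesis .
  qed
  ultimately show "sim_on {0<..} E (\<lambda>t. ennreal (t powr (- 1 / p)))"
    unfolding sim_on_def using C(1) D by (intro exI[of _ "1 / C"] exI[of _ D]) auto
qed

end
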